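(* Suppose that the system $A\vec{x}=\vec{b}$ has a unique solution, denoted by $\vec{x}^{S}$. Then there exists a constant $\alpha<1$ such that the iterates $\vec{x}^{(n)}$ of the (unrelaxed) distributed Kaczmarz algorithm satisfy $$\| \vec{x}^{S}-\vec{x}^{(n+1)}\|\le \alpha\,\|\vec{x}^{S}-\vec{x}^{(n)}\|.$$ Consequently, $\lim_{n\to\infty}\vec{x}^{(n)}=\vec{x}^{S}$, and the convergence is linear in order.
   Context: A finite tree with root $r$ is given. Each node $v$ carries a nonzero vector $\vec{a}_v\in\mathbb{C}^d$ and a scalar $b_v\in\mathbb{C}$. The dot product $\vec{a}\cdot\vec{z}=\sum_k a_kz_k$ is linear in both variables, $S_v:\mathbb{C}^d\to\mathbb{C}$ is $S_v\vec{z}=\vec{a}_v\cdot\vec{z}$, and $A\vec{x}=\vec{b}$ denotes the system of equations $S_v\vec{x}=b_v$ over all nodes $v$ (so $A$ is the matrix with rows $\vec{a}_v^{T}$). $\|\cdot\|$ is the Euclidean norm. For each node $v$, $\mathcal{C}(v)$ is the set of children (immediate successors) of $v$; a leaf is a node with no children. Each edge between a node $v$ and a child $u\in\mathcal{C}(v)$ carries a weight $w(u,v)>0$, with $\sum_{u\in\mathcal{C}(v)}w(u,v)=1$ for every non-leaf $v$. For each node $v$ let $Q_v(\vec{z})=\vec{z}+S_v^*(S_vS_v^* )^{-1}(b_v-S_v\vec{z})$ (the affine orthogonal projection onto $\{\vec{z}: S_v\vec{z}=b_v\}$). Distributed Kaczmarz algorithm: start with an arbitrary $\vec{x}^{(0)}\in\mathbb{C}^d$.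 Given $\vec{x}^{(n)}$: (dispersion stage) set $\vec{x}^{(n)}_r=Q_r\vec{x}^{(n)}$ and, for each child $u$ of a node $v$, $\vec{x}^{(n)}_u=Q_u\vec{x}^{(n)}_v$; (pooling stage) set $\vec{y}^{(n)}_\ell=\vec{x}^{(n)}_\ell$ for each leaf $\ell$ and, for each non-leaf $v$, $\vec{y}^{(n)}_v=\sum_{u\in\mathcal{C}(v)}w(u,v)\vec{y}^{(n)}_u$. Then $\vec{x}^{(n+1)}=\vec{y}^{(n)}_r$. *)

theory Defs
  imports "HOL-Analysis.Analysis"
begin

text \<open>
  A finite tree with root \<open>r\<close> on the node set \<open>V\<close>. Its edges are oriented away from the root:
  \<open>(v, u) \<in> E\<close> means that \<open>u\<close> is a child of \<open>v\<close>.
\<close>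

definition rooted_tree :: "'v set \<Rightarrow> ('v \<times> 'v) set \<Rightarrow> 'v \<Rightarrow> bool" where
  "rooted_tree V E r \<longleftrightarrow>
     finite V \<and> r \<in> V \<and> E \<subseteq> V \<times> V \<and>
     r \<notin> Range E \<and>
     (\<forall>u\<in>V - {r}. \<exists>!v. (v, u) \<in> E) \<and>
     (\<forall>v\<in>V. (r, v) \<in> E\<^sup>*)"

definition children :: "('v \<times> 'v) set \<Rightarrow> 'v \<Rightarrow> 'v set" where
  "children E v = {u. (v, u) \<in> E}"

definition leaf :: "('v \<times> 'v) set \<Rightarrow> 'v \<Rightarrow> bool" where
  "leaf E v \<longleftrightarrow> children E v = {}"

definition tree_weights :: "'v set \<Rightarrow> ('v \<times> 'v) set \<Rightarrow> ('v \<Rightarrow> 'v \<Rightarrow> real) \<Rightarrow> bool" where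
  "tree_weights V E w \<longleftrightarrow>
     (\<forall>v\<in>V. \<forall>u\<in>children E v. w u v > 0) \<and>
     (\<forall>v\<in>V. \<not> leaf E v \<longrightarrow> (\<Sum>u\<in>children E v. w u v) = 1)"

text \<open>
  \<open>row_map a\<close> is \<open>S\<close> for the row \<open>a\<close>. The product is bilinear, without conjugation, unlike the
  Hermitian inner product.
\<close>

definition row_map :: "complex ^ 'd \<Rightarrow> complex ^ 'd \<Rightarrow> complex" where
  "row_map a z = (\<Sum>k\<in>UNIV. a $ k * z $ k)"

definition row_adj :: "complex ^ 'd \<Rightarrow> complex \<Rightarrow> complex ^ 'd" where
  "row_adj a c = (\<chi> k. c * cnj (a $ k))"

text \<open>\<open>row_adj a\<close> is \<open>S\<^sup>*\<close>, the adjoint of \<open>row_map a\<close> for the Hermitian inner products.\<close>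

lemma row_adj_adjoint:
  "row_map a z * cnj c = (\<Sum>k\<in>UNIV. z $ k * cnj (row_adj a c $ k))"
  unfolding row_map_def row_adj_def sum_distrib_right
  by (intro sum.cong refl) simp

lemma row_map_row_adj:
  "row_map a (row_adj a c) = complex_of_real ((norm a)\<^sup>2) * c"
proof -
  have "row_map a (row_adj a c) = (\<Sum>k\<in>UNIV. complex_of_real ((cmod (a $ k))\<^sup>2)) * c"
    unfolding row_map_def row_adj_def sum_distrib_right
    by (intro sum.cong refl) (simp add: complex_norm_square mult_ac del: of_real_power)
  also have "(\<Sum>k\<in>UNIV. complex_of_real ((cmod (a $ k))\<^sup>2)) = complex_of_real ((norm a)\<^sup>2)"
    by (simp add: norm_vec_def L2_set_def sum_nonneg del: of_real_power flip: of_real_sum)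
  finally show ?thesis .
qed

lemma bij_row_map_row_adj:
  assumes "a \<noteq> 0"
  shows "bij (\<lambda>c. row_map a (row_adj a c))"
  unfolding row_map_row_adj
  by (rule bij_betw_byWitness[where f' = "\<lambda>c. c / complex_of_real ((norm a)\<^sup>2)"])
     (use assms in auto)

definition row_proj :: "complex ^ 'd \<Rightarrow> complex \<Rightarrow> complex ^ 'd \<Rightarrow> complex ^ 'd" where
  "row_proj a \<beta> z = z + row_adj a (inv (\<lambda>c. row_map a (row_adj a c)) (\<beta> - row_map a z))"

definition solves ::
    "'v set \<Rightarrow> ('v \<Rightarrow> complex ^ 'd) \<Rightarrow> ('v \<Rightarrow> complex) \<Rightarrow> complex ^ 'd \<Rightarrow> bool" where
  "solves V a b x \<longleftrightarrow> (\<forall>v\<in>V. row_map (a v) x = b v)"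

definition dispersion ::
    "('v \<times> 'v) set \<Rightarrow> 'v \<Rightarrow> ('v \<Rightarrow> complex ^ 'd) \<Rightarrow> ('v \<Rightarrow> complex) \<Rightarrow>
     complex ^ 'd \<Rightarrow> ('v \<Rightarrow> complex ^ 'd) \<Rightarrow> bool" where
  "dispersion E r a b z X \<longleftrightarrow>
     X r = row_proj (a r) (b r) z \<and>
     (\<forall>v u. (v, u) \<in> E \<longrightarrow> X u = row_proj (a u) (b u) (X v))"

definition pooling ::
    "'v set \<Rightarrow> ('v \<times> 'v) set \<Rightarrow> ('v \<Rightarrow> 'v \<Rightarrow> real) \<Rightarrow>
     ('v \<Rightarrow> complex ^ 'd) \<Rightarrow> ('v \<Rightarrow> complex ^ 'd) \<Rightarrow> bool" where
  "pooling V E w X Y \<longleftrightarrow>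
     (\<forall>v\<in>V. Y v = (if leaf E v then X v else \<Sum>u\<in>children E v. w u v *\<^sub>R Y u))"

text \<open>
  \<open>x\<close> is a sequence of iterates, from an arbitrary start \<open>x 0\<close>. On a rooted tree the node values
  \<open>X\<close> and \<open>Y\<close> of each round exist and are unique on \<open>V\<close>, so \<open>x 0\<close> determines \<open>x\<close>; existence is
  shown in \<open>kaczmarz_iterates_exist\<close>.
\<close>

definition kaczmarz_iterates ::
    "'v set \<Rightarrow> ('v \<times> 'v) set \<Rightarrow> 'v \<Rightarrow> ('v \<Rightarrow> 'v \<Rightarrow> real) \<Rightarrow>
     ('v \<Rightarrow> complex ^ 'd) \<Rightarrow> ('v \<Rightarrow> complex) \<Rightarrow> (nat \<Rightarrow> complex ^ 'd) \<Rightarrow> bool" where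
  "kaczmarz_iterates V E r w a b x \<longleftrightarrow>
     (\<forall>n. \<exists>X Y. dispersion E r a b (x n) X \<and> pooling V E w X Y \<and> x (Suc n) = Y r)"

lemma rooted_tree_acyclic:
  assumes "rooted_tree V E r"
  shows "acyclic E"
proof -
  have E: "E \<subseteq> V \<times> V" and r: "r \<notin> Range E"
    and par: "\<And>v v' u. (v, u) \<in> E \<Longrightarrow> (v', u) \<in> E \<Longrightarrow> v = v'"
    and reach: "\<And>v. v \<in> V \<Longrightarrow> (r, v) \<in> E\<^sup>*"
    using assms unfolding rooted_tree_def by blast+
  have "(v, v) \<notin> E\<^sup>+" if "(r, v) \<in> E\<^sup>*" for v
    using that
  proof (induction rule: rtrancl_induct)
    case base
    show ?case using r by (metis Range.intros tranclD2)
  next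
    case (step y u)
    show ?case
    proof
      assume "(u, u) \<in> E\<^sup>+"
      then obtain p where "(u, p) \<in> E\<^sup>*" "(p, u) \<in> E"
        by (meson tranclD2)
      with par step.hyps(2) have "(u, y) \<in> E\<^sup>*" by metis
      with step.hyps(2) have "(y, y) \<in> E\<^sup>+" by (rule rtrancl_into_trancl2)
      with step.IH show False by simp
    qed
  qed
  moreover have "v \<in> V" if "(v, v) \<in> E\<^sup>+" for v
    using that E by (meson SigmaD1 subsetD tranclD)
  ultimately show ?thesis
    using reach unfolding acyclic_def by blast
qed

lemma wf_recursion_exists:
  assumes "wf R"
    and "\<And>f g v. (\<And>u. (u, v) \<in> R \<Longrightarrow> f u = g u) \<Longrightarrow> F f v = F g v"
  shows "\<exists>f. \<forall>v. f v = F f v"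
proof -
  have "adm_wf R F"
    using assms(2) unfolding adm_wf_def by blast
  then have "wfrec R F = F (wfrec R F)"
    by (rule wfrec_fixpoint[OF assms(1)])
  then show ?thesis by metis
qed

lemma kaczmarz_iterates_exist:
  fixes E :: "('v \<times> 'v) set" and x0 :: "complex ^ 'd"
  assumes tree: "rooted_tree V E r"
  shows "\<exists>x. x 0 = x0 \<and> kaczmarz_iterates V E r w a b x"
proof -
  have r: "r \<notin> Range E"
    and par: "\<And>v v' u. (v, u) \<in> E \<Longrightarrow> (v', u) \<in> E \<Longrightarrow> v = v'"
    and "finite E"
    using tree finite_subset[of E "V \<times> V"] unfolding rooted_tree_def by blast+
  with rooted_tree_acyclic[OF tree] have wf: "wf E" "wf (E\<inverse>)"
    by (simp_all add: finite_acyclic_wf finite_acyclic_wf_converse)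
  have "\<exists>X Y. dispersion E r a b z X \<and> pooling V E w X Y" for z
  proof -
    have "\<exists>X. \<forall>u. X u = row_proj (a u) (b u) (if u \<in> Range E then X (THE v. (v, u) \<in> E) else z)"
    proof (rule wf_recursion_exists[OF wf(1)])
      fix f g :: "'v \<Rightarrow> complex ^ 'd" and u
      assume "\<And>v. (v, u) \<in> E \<Longrightarrow> f v = g v"
      moreover have "(THE v. (v, u) \<in> E, u) \<in> E" if "u \<in> Range E"
        using that par by (metis RangeE theI)
      ultimately show
        "row_proj (a u) (b u) (if u \<in> Range E then f (THE v. (v, u) \<in> E) else z) =
         row_proj (a u) (b u) (if u \<in> Range E then g (THE v. (v, u) \<in> E) else z)"
        by simp
    qed
    then obtain X where X: "\<And>u. X u =
        row_proj (a u) (b u) (if u \<in> Range E then X (THE v. (v, u) \<in> E) else z)"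
      by blast
    have "X u = row_proj (a u) (b u) (X v)" if "(v, u) \<in> E" for v u
    proof -
      have "(THE v. (v, u) \<in> E) = v" using that par by blast
      then show ?thesis using X[of u] that by (simp add: Range.intros)
    qed
    then have "dispersion E r a b z X"
      using X[of r] r by (simp add: dispersion_def)
    moreover have "\<exists>Y. \<forall>v. Y v = (if leaf E v then X v else \<Sum>u\<in>children E v. w u v *\<^sub>R Y u)"
      by (rule wf_recursion_exists[OF wf(2)]) (simp add: children_def)
    ultimately show ?thesis unfolding pooling_def by blast
  qed
  then obtain X Y where
    XY: "\<And>z. dispersion E r a b z (X z) \<and> pooling V E w (X z) (Y z)"
    by metis
  show ?thesis
    by (rule exI[of _ "rec_nat x0 (\<lambda>_ z. Y z r)"])
       (use XY in \<open>auto simp: kaczmarz_iterates_def\<close>)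
qed

definition converges_linearly :: "(nat \<Rightarrow> 'a::real_normed_vector) \<Rightarrow> 'a \<Rightarrow> bool" where
  "converges_linearly x L \<longleftrightarrow>
     x \<longlonglongrightarrow> L \<and>
     (\<exists>\<mu>. 0 \<le> \<mu> \<and> \<mu> < 1 \<and>
        (\<forall>\<^sub>F n in sequentially. norm (L - x (Suc n)) \<le> \<mu> * norm (L - x n)))"

end

theory Submission
  imports Defs
begin

text \<open>
  In terms of the error \<open>e = z - x\<^sup>S\<close> each \<open>Q\<^sub>v\<close> becomes the orthogonal projection onto
  \<open>ker S\<^sub>v\<close>, so one round maps the error by a linear map built from such projections by
  composition and convex combination. This map does not increase the norm, and it preserves
  \<open>\<parallel>e\<parallel>\<close> only if every projection along every branch fixes \<open>e\<close>, that is, only if \<open>S\<^sub>v e = 0\<close>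
  for all \<open>v\<close>; then \<open>x\<^sup>S + e\<close> is a solution too and \<open>e = 0\<close>. Compactness of the unit sphere
  yields a uniform factor \<open>\<alpha> < 1\<close>.
\<close>

section \<open>Row projections and their linear parts\<close>

lemma row_map_add: "row_map a (x + y) = row_map a x + row_map a y"
  by (simp add: row_map_def algebra_simps sum.distrib)

lemma row_map_diff: "row_map a (x - y) = row_map a x - row_map a y"
  by (simp add: row_map_def algebra_simps sum_subtractf)

lemma row_map_scaleR: "row_map a (c *\<^sub>R x) = c *\<^sub>R row_map a x"
  by (simp add: row_map_def scaleR_sum_right)

text \<open>The real inner product on \<open>complex ^ 'd\<close> is the real part of the Hermitian
  one, so adjointness carries over and real orthogonality becomes available.\<close>

lemma inner_row_adj: "x \<bullet> row_adj a c = Re (row_map a x * cnj c)"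
  unfolding row_adj_adjoint by (simp add: inner_vec_def inner_complex_def)

lemma row_proj_eq:
  assumes "a \<noteq> 0"
  shows "row_proj a \<beta> z = z + row_adj a ((\<beta> - row_map a z) / complex_of_real ((norm a)\<^sup>2))"
proof -
  have "inv (\<lambda>c. row_map a (row_adj a c)) y = y / complex_of_real ((norm a)\<^sup>2)" for y
    by (rule inv_f_eq[OF bij_is_inj[OF bij_row_map_row_adj[OF assms]]])
      (use assms in \<open>simp add: row_map_row_adj\<close>)
  then show ?thesis by (simp add: row_proj_def)
qed

text \<open>As \<open>x\<close> lies on the hyperplane, the residual of \<open>z\<close> depends on
  the error \<open>z - x\<close> alone.\<close>

lemma row_proj_diff:
  assumes "a \<noteq> 0" "row_map a x = \<beta>"
  shows "row_proj a \<beta> z - x = row_proj a 0 (z - x)"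
  using assms by (simp add: row_proj_eq row_map_diff)

lemma linear_row_proj_0:
  assumes "a \<noteq> 0"
  shows "linear (row_proj a 0)"
  by (rule linearI)
    (use assms in \<open>simp_all add: row_proj_eq row_map_add row_map_scaleR row_adj_def vec_eq_iff
      add_divide_distrib diff_divide_distrib algebra_simps scaleR_conv_of_real[where 'a = complex]\<close>)

lemma row_map_row_proj:
  assumes "a \<noteq> 0"
  shows "row_map a (row_proj a \<beta> z) = \<beta>"
  using assms by (simp add: row_proj_eq row_map_add row_map_row_adj)

lemma row_proj_0_fix:
  assumes "a \<noteq> 0" "row_map a z = 0"
  shows "row_proj a 0 z = z"
  using assms by (simp add: row_proj_eq row_adj_def vec_eq_iff)

text \<open>The projection lies in the kernel of \<open>row_map a\<close>, the correction in the
  range of \<open>row_adj a\<close>; these are orthogonal.\<close>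

lemma norm_row_proj_0_Pythagoras:
  assumes "a \<noteq> 0"
  shows "(norm z)\<^sup>2 = (norm (row_proj a 0 z))\<^sup>2 + (norm (z - row_proj a 0 z))\<^sup>2"
proof -
  define p c where "p = row_proj a 0 z" and "c = - row_map a z / complex_of_real ((norm a)\<^sup>2)"
  have p: "p = z + row_adj a c"
    using assms by (simp add: p_def c_def row_proj_eq)
  have "p \<bullet> row_adj a c = 0"
    using row_map_row_proj[OF assms, of 0 z] by (simp add: inner_row_adj p_def)
  then have "orthogonal p (z - p)"
    by (simp add: orthogonal_def p)
  from norm_add_Pythagorean[OF this] show ?thesis
    by (simp add: p_def)
qed

lemma norm_row_proj_0_le:
  assumes "a \<noteq> 0"
  shows "norm (row_proj a 0 z) \<le> norm z"
  by (rule power2_le_imp_le) (use norm_row_proj_0_Pythagoras[OF assms, of z] in simp_all)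

lemma norm_row_proj_0_eqD:
  assumes "a \<noteq> 0" "norm (row_proj a 0 z) = norm z"
  shows "row_map a z = 0"
proof -
  have "z = row_proj a 0 z"
    using norm_row_proj_0_Pythagoras[OF assms(1), of z] assms(2) by simp
  then show ?thesis
    using row_map_row_proj[OF assms(1), of 0 z] by simp
qed

section \<open>Norms of convex combinations\<close>

lemma norm_convex_combination_le:
  fixes f :: "'i \<Rightarrow> 'a::real_normed_vector"
  assumes "\<And>i. i \<in> I \<Longrightarrow> 0 \<le> c i" "sum c I = 1" "\<And>i. i \<in> I \<Longrightarrow> norm (f i) \<le> B"
  shows "norm (\<Sum>i\<in>I. c i *\<^sub>R f i) \<le> B"
proof -
  have "norm (\<Sum>i\<in>I. c i *\<^sub>R f i) \<le> (\<Sum>i\<in>I. c i * B)"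
    by (rule sum_norm_le) (use assms in \<open>simp add: mult_left_mono\<close>)
  then show ?thesis
    using assms(2) by (simp flip: sum_distrib_right)
qed

text \<open>By the triangle inequality the average of the norms is at least \<open>B\<close>; one
  shorter term, having positive weight, would pull it strictly below.\<close>

lemma norm_convex_combination_eqD:
  fixes f :: "'i \<Rightarrow> 'a::real_normed_vector"
  assumes "finite I" "\<And>i. i \<in> I \<Longrightarrow> 0 < c i" "sum c I = 1"
    and "\<And>i. i \<in> I \<Longrightarrow> norm (f i) \<le> B"
    and "norm (\<Sum>i\<in>I. c i *\<^sub>R f i) = B" "i \<in> I"
  shows "norm (f i) = B"
proof (rule ccontr)
  assume "norm (f i) \<noteq> B"
  then have "norm (f i) < B"
    using assms(4,6) by fastforce
  then have "(\<Sum>i\<in>I. norm (c i *\<^sub>R f i)) < (\<Sum>i\<in>I. c i * B)"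
    using assms by (intro sum_strict_mono_ex1) (auto simp: less_imp_le abs_of_pos)
  moreover have "norm (\<Sum>i\<in>I. c i *\<^sub>R f i) \<le> (\<Sum>i\<in>I. norm (c i *\<^sub>R f i))"
    by (rule norm_sum)
  ultimately show False
    using assms(3,5) by (simp flip: sum_distrib_right)
qed

section \<open>Error maps of subtrees\<close>

text \<open>
  \<open>L\<close> maps the error of the dispersed value at \<open>v\<close> to the error of the pooled value at \<open>v\<close>;
  only the strict descendants of \<open>v\<close> act in between, hence \<open>E\<^sup>+\<close>.
\<close>

lemma subtree_error_map_exists:
  fixes E :: "('v \<times> 'v) set" and a :: "'v \<Rightarrow> complex ^ 'd"
  assumes tree: "rooted_tree V E r"
    and weights: "tree_weights V E w"
    and nz: "\<And>v. v \<in> V \<Longrightarrow> a v \<noteq> 0"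
    and sol: "solves V a b xS"
    and "v \<in> V"
  shows "\<exists>L. linear L \<and>
           (\<forall>z X Y. dispersion E r a b z X \<longrightarrow> pooling V E w X Y \<longrightarrow> Y v - xS = L (X v - xS)) \<and>
           (\<forall>e. norm (L e) \<le> norm e) \<and>
           (\<forall>e. norm (L e) = norm e \<longrightarrow> (\<forall>u. (v, u) \<in> E\<^sup>+ \<longrightarrow> row_map (a u) e = 0))"
    (is "\<exists>L. ?P v L")
proof -
  have E: "E \<subseteq> V \<times> V" and fin: "finite E"
    using tree finite_subset[of E "V \<times> V"] unfolding rooted_tree_def by blast+
  \<comment> \<open>Induction along \<open>E\<inverse>\<close> runs from the leaves towards the
    root.\<close>
  with rooted_tree_acyclic[OF tree] have "wf (E\<inverse>)"
    by (simp add: finite_acyclic_wf_converse)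
  then show ?thesis
    using \<open>v \<in> V\<close>
  proof (induction v rule: wf_induct_rule)
    case (less v)
    let ?C = "children E v"
    show ?case
    proof (cases "leaf E v")
      case True
      then have "(v, u) \<notin> E\<^sup>+" for u
        by (auto simp: leaf_def children_def dest: tranclD)
      \<comment> \<open>At a leaf pooling returns the dispersed value, and the equality condition is
        vacuous.\<close>
      then have "?P v (\<lambda>e. e)"
        using True less.prems by (auto simp: pooling_def linear_id[unfolded id_def])
      then show ?thesis by blast
    next
      case False
      have CV: "u \<in> V" if "u \<in> ?C" for u
        using that E by (auto simp: children_def)
      have "\<exists>L. ?P u L" if "u \<in> ?C" for u
        using less.IH[of u] that CV by (simp add: children_def)
      then obtain K where K: "\<And>u. u \<in> ?C \<Longrightarrow> ?P u (K u)"
        by metis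
      have finC: "finite ?C"
        by (rule finite_subset[of _ "Range E"]) (use fin in \<open>auto simp: children_def finite_Range\<close>)
      have w: "w u v > 0" if "u \<in> ?C" for u
        using weights less.prems that by (auto simp: tree_weights_def)
      have w1: "(\<Sum>u\<in>?C. w u v) = 1"
        using weights less.prems False by (auto simp: tree_weights_def)
      \<comment> \<open>\<open>G u\<close> follows the branch through \<open>u\<close>: projection
        at \<open>u\<close>, then the error map of the subtree below. Pooling averages the
        branches.\<close>
      define G where "G u e = K u (row_proj (a u) 0 e)" for u e
      define L where "L e = (\<Sum>u\<in>?C. w u v *\<^sub>R G u e)" for e
      have G_le: "norm (G u e) \<le> norm e" if "u \<in> ?C" for u e
        using K[OF that] norm_row_proj_0_le[OF nz[OF CV[OF that]], of e] order_trans
        unfolding G_def by blast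
      have "linear (G u)" if "u \<in> ?C" for u
        using linear_compose[OF linear_row_proj_0[OF nz[OF CV[OF that]]], of "K u"] K[OF that]
        by (simp add: G_def[abs_def] o_def)
      then have "linear L"
        unfolding L_def[abs_def]
        by (intro linear_compose_sum ballI linear_compose_scale_right) auto
      moreover have "Y v - xS = L (X v - xS)"
        if d: "dispersion E r a b z X" and p: "pooling V E w X Y" for z X Y
      proof -
        have "Y u - xS = G u (X v - xS)" if u: "u \<in> ?C" for u
        proof -
          have "X u = row_proj (a u) (b u) (X v)"
            using d u by (auto simp: dispersion_def children_def)
          moreover have "row_map (a u) xS = b u"
            using sol CV[OF u] by (simp add: solves_def)
          ultimately show ?thesis
            using K[OF u] d p row_proj_diff[OF nz[OF CV[OF u]]] by (simp add: G_def)
        qed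
        then have "L (X v - xS) = (\<Sum>u\<in>?C. w u v *\<^sub>R (Y u - xS))"
          by (simp add: L_def)
        \<comment> \<open>Weights of sum 1 leave the constant \<open>xS\<close> unchanged under
          averaging.\<close>
        also have "\<dots> = (\<Sum>u\<in>?C. w u v *\<^sub>R Y u) - xS"
          using w1 by (simp add: scaleR_diff_right sum_subtractf flip: scaleR_sum_left)
        finally show ?thesis
          using p False less.prems by (simp add: pooling_def)
      qed
      moreover have "norm (L e) \<le> norm e" for e
        unfolding L_def
        by (rule norm_convex_combination_le) (use w w1 G_le in \<open>auto simp: less_imp_le\<close>)
      moreover have "row_map (a u) e = 0" if L: "norm (L e) = norm e" and "(v, u) \<in> E\<^sup>+" for e u
      proof -
        \<comment> \<open>The path to \<open>u\<close> starts with an edge to a child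
          \<open>c\<close>; the rest may be empty, in which case \<open>u = c\<close>.\<close>
        obtain c where c: "c \<in> ?C" and cu: "(c, u) \<in> E\<^sup>*"
          using \<open>(v, u) \<in> E\<^sup>+\<close> by (auto simp: children_def dest: tranclD)
        have G_eq: "norm (G c e) = norm e"
          by (rule norm_convex_combination_eqD[OF finC w w1 G_le L[unfolded L_def] c])
        have ac: "a c \<noteq> 0"
          using nz CV c by blast
        have "norm (G c e) \<le> norm (row_proj (a c) 0 e)"
          using K[OF c] by (simp add: G_def)
        then have Sc: "row_map (a c) e = 0"
          using G_eq norm_row_proj_0_le[OF ac, of e] norm_row_proj_0_eqD[OF ac, of e] by simp
        \<comment> \<open>The projection at \<open>c\<close> fixes \<open>e\<close>, so the equality
          case of the induction hypothesis applies to \<open>e\<close> itself.\<close>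
        then have "norm (K c e) = norm e"
          using G_eq row_proj_0_fix[OF ac] by (simp add: G_def)
        then show ?thesis
          using K[OF c] Sc cu by (metis rtranclD)
      qed
      ultimately have "?P v L" by blast
      then show ?thesis by blast
    qed
  qed
qed

section \<open>Uniform contraction and convergence\<close>

text \<open>The factor is the maximum of \<open>norm (M e)\<close> on the compact unit sphere: it is
  attained, hence below 1, and homogeneity extends the bound to all \<open>e\<close>.\<close>

lemma linear_strict_contraction_factor:
  fixes M :: "'a::euclidean_space \<Rightarrow> 'b::real_normed_vector"
  assumes "linear M" and less: "\<And>e. e \<noteq> 0 \<Longrightarrow> norm (M e) < norm e"
  obtains \<alpha> where "0 \<le> \<alpha>" "\<alpha> < 1" "\<And>e. norm (M e) \<le> \<alpha> * norm e"
proof -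
  have "continuous_on (sphere 0 1) (\<lambda>e. norm (M e))"
    using assms(1) by (intro continuous_on_norm linear_continuous_on) (simp add: linear_linear)
  moreover have "sphere (0::'a) 1 \<noteq> {}"
    by simp
  ultimately obtain s where s: "norm s = 1" and
    max: "\<And>e. norm e = 1 \<Longrightarrow> norm (M e) \<le> norm (M s)"
    using continuous_attains_sup[of "sphere (0::'a) 1" "\<lambda>e. norm (M e)"] by auto
  show thesis
  proof
    show "0 \<le> norm (M s)" by simp
    show "norm (M s) < 1" using less[of s] s by force
    show "norm (M e) \<le> norm (M s) * norm e" for e
    proof (cases "e = 0")
      case True
      then show ?thesis using linear_0[OF assms(1)] by simp
    next
      case False
      then have "norm (M (e /\<^sub>R norm e)) \<le> norm (M s)"
        by (intro max) simp
      then show ?thesis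
        using False by (simp add: linear_scale[OF assms(1)] field_simps)
    qed
  qed
qed

lemma contraction_tendsto:
  fixes x :: "nat \<Rightarrow> 'a::real_normed_vector"
  assumes "0 \<le> \<alpha>" "\<alpha> < 1" and step: "\<And>n. norm (L - x (Suc n)) \<le> \<alpha> * norm (L - x n)"
  shows "x \<longlonglongrightarrow> L"
proof -
  have bound: "norm (x n - L) \<le> norm (x 0 - L) * \<alpha> ^ n" for n
  proof (induction n)
    case (Suc n)
    have "norm (x (Suc n) - L) \<le> \<alpha> * norm (x n - L)"
      using step[of n] by (simp add: norm_minus_commute)
    also have "\<dots> \<le> \<alpha> * (norm (x 0 - L) * \<alpha> ^ n)"
      using Suc assms(1) by (rule mult_left_mono)
    finally show ?case by (simp add: mult_ac)
  qed simp
  have "(\<lambda>n. \<alpha> ^ n) \<longlonglongrightarrow> 0"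
    using assms by (intro LIMSEQ_power_zero) simp
  then have "(\<lambda>n. norm (x 0 - L) * \<alpha> ^ n) \<longlonglongrightarrow> 0"
    by (rule tendsto_mult_right_zero)
  then have "(\<lambda>n. x n - L) \<longlonglongrightarrow> 0"
    by (rule Lim_null_comparison[rotated]) (simp add: bound)
  then show ?thesis
    by (simp add: LIM_zero_iff)
qed

theorem theorem2:
  fixes V :: "'v set" and E :: "('v \<times> 'v) set" and r :: 'v
    and w :: "'v \<Rightarrow> 'v \<Rightarrow> real"
    and a :: "'v \<Rightarrow> complex ^ 'd" and b :: "'v \<Rightarrow> complex"
    and xS :: "complex ^ 'd"
  assumes "rooted_tree V E r"
    and "tree_weights V E w"
    and "\<And>v. v \<in> V \<Longrightarrow> a v \<noteq> 0"
    and "solves V a b xS"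
    and "\<And>z. solves V a b z \<Longrightarrow> z = xS"
  shows "(\<exists>\<alpha>. 0 \<le> \<alpha> \<and> \<alpha> < 1 \<and>
            (\<forall>x. kaczmarz_iterates V E r w a b x \<longrightarrow>
               (\<forall>n. norm (xS - x (Suc n)) \<le> \<alpha> * norm (xS - x n)))) \<and>
         (\<forall>x. kaczmarz_iterates V E r w a b x \<longrightarrow>
            x \<longlonglongrightarrow> xS \<and> converges_linearly x xS)"
proof -
  have r: "r \<in> V" and reach: "\<And>v. v \<in> V \<Longrightarrow> (r, v) \<in> E\<^sup>*"
    using assms(1) by (auto simp: rooted_tree_def)
  obtain L where L: "linear L"
    and L_err: "\<And>z X Y. dispersion E r a b z X \<Longrightarrow> pooling V E w X Y \<Longrightarrow> Y r - xS = L (X r - xS)"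
    and L_le: "\<And>e. norm (L e) \<le> norm e"
    and L_eq: "\<And>e u. norm (L e) = norm e \<Longrightarrow> (r, u) \<in> E\<^sup>+ \<Longrightarrow> row_map (a u) e = 0"
    using subtree_error_map_exists[OF assms(1-4) r] by blast
  note ar = assms(3)[OF r]
  \<comment> \<open>\<open>L\<close> starts from the dispersed value at the root, so the projection
    at \<open>r\<close> has to be composed with it to obtain the error map of a full round.\<close>
  define M where "M e = L (row_proj (a r) 0 e)" for e
  have "linear M"
    using linear_compose[OF linear_row_proj_0[OF ar] L] by (simp add: M_def[abs_def] o_def)
  moreover have "norm (M e) < norm e" if "e \<noteq> 0" for e
  proof (rule ccontr)
    assume "\<not> norm (M e) < norm e"
    then have eq: "norm (row_proj (a r) 0 e) = norm e" "norm (M e) = norm e"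
      using L_le[of "row_proj (a r) 0 e"] norm_row_proj_0_le[OF ar, of e] by (simp_all add: M_def)
    then have Sr: "row_map (a r) e = 0"
      using norm_row_proj_0_eqD[OF ar] by blast
    then have "norm (L e) = norm e"
      using eq row_proj_0_fix[OF ar] by (simp add: M_def)
    \<comment> \<open>The root is covered by \<open>Sr\<close>, every other node is a strict
      descendant of it.\<close>
    then have "row_map (a v) e = 0" if "v \<in> V" for v
      using L_eq Sr reach[OF that] by (metis rtranclD)
    then have "solves V a b (xS + e)"
      using assms(4) by (simp add: solves_def row_map_add)
    then show False
      using assms(5) that by fastforce
  qed
  \<comment> \<open>\<open>M\<close> is fixed by the tree and the system, so one \<alpha> serves all
    iterate sequences.\<close>
  ultimately obtain \<alpha> where \<alpha>: "0 \<le> \<alpha>" "\<alpha> < 1" and M: "\<And>e. norm (M e) \<le> \<alpha> * norm e"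
    using linear_strict_contraction_factor by blast
  have step: "norm (xS - x (Suc n)) \<le> \<alpha> * norm (xS - x n)"
    if x: "kaczmarz_iterates V E r w a b x" for x n
  proof -
    obtain X Y where XY: "dispersion E r a b (x n) X" "pooling V E w X Y" "x (Suc n) = Y r"
      using x unfolding kaczmarz_iterates_def by blast
    have "row_map (a r) xS = b r"
      using assms(4) r by (simp add: solves_def)
    then have "X r - xS = row_proj (a r) 0 (x n - xS)"
      using XY(1) row_proj_diff[OF ar] by (simp add: dispersion_def)
    then have "x (Suc n) - xS = M (x n - xS)"
      using L_err[OF XY(1,2)] XY(3) by (simp add: M_def)
    then show ?thesis
      using M[of "x n - xS"] by (metis norm_minus_commute)
  qed
  have "x \<longlonglongrightarrow> xS" if "kaczmarz_iterates V E r w a b x" for x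
    by (rule contraction_tendsto[OF \<alpha>]) (rule step[OF that])
  then show ?thesis
    unfolding converges_linearly_def using \<alpha> step by (blast intro: always_eventually)
qed

end
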